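(* Let $\Gamma$, $A$, $S$, $H$ be as in the context and let $\gamma,\tau\in\Gamma$ with $c_\gamma c_\tau c_{\gamma\tau}\neq0$. Then $$H(\gamma)-H(\gamma\tau)=A\left(\frac{d_\gamma}{c_\gamma}-\frac{d_{\gamma\tau}}{c_{\gamma\tau}}+\frac{c_\tau}{c_\gamma c_{\gamma\tau}}\right)+S(\tau)+\frac14\big(\mathrm{sgn}(c_\tau)-\mathrm{sgn}(c_\gamma c_\tau c_{\gamma\tau})\big).$$ If moreover $\Gamma\backslash\mathbb{H}$ has positive genus and $f$ is a fixed nonzero weight $2$ cusp form for $\Gamma$, then, with $\theta=S^*-S$, $$H^*(\gamma)-H^*(\gamma\tau)=A\left(\frac{d_\gamma}{c_\gamma}-\frac{d_{\gamma\tau}}{c_{\gamma\tau}}+\frac{c_\tau}{c_\gamma c_{\gamma\tau}}\right)-\theta(\tau)-\frac{V_f}{2\pi}\mathrm{Im}\left(\langle\gamma,f\rangle\overline{\langle\tau,f\rangle}\right).$$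
   Context: Let $\Gamma\subset \mathrm{SL}(2,\mathbb{R})$ be a Fuchsian group of the first kind (discrete, with $\Gamma\backslash\mathbb{H}$ of finite hyperbolic area $V_\Gamma$) having a cusp at $\infty$, normalized so that $P_\infty=\left(\begin{smallmatrix}1&1\\0&1\end{smallmatrix}\right)\in\Gamma$ and the stabilizer $\Gamma_\infty$ of $\infty$ in $\Gamma$ is generated by $P_\infty$ together with $-I$ when $-I\in\Gamma$. Put $A=V_\Gamma/(4\pi)$. For $\gamma\in\Gamma$ write $\gamma=\left(\begin{smallmatrix} a_\gamma&b_\gamma\\ c_\gamma&d_\gamma\end{smallmatrix}\right)$, $j(\gamma,z)=c_\gamma z+d_\gamma$; $\mathrm{sgn}(r)=r/|r|$ for $r\neq0$, $\mathrm{sgn}(0)=0$; principal branch of logarithm. Modular Dedekind symbol $S:\Gamma\to\mathbb{R}$: with $\eta_{\Gamma,\infty}$ the nowhere-vanishing holomorphic function on $\mathbb{H}$ arising in the Kronecker limit formula at $s=1$ of $E_\infty(z,s)=\sum_{\gamma\in\Gamma_\infty\backslash\Gamma}\mathrm{Im}(\gamma z)^s$ (the Dedekind eta function when $\Gamma=\mathrm{SL}(2,\mathbb{Z})$), $\log\eta_{\Gamma,\infty}(\gamma z)=\log\eta_{\Gamma,\infty}(z)+\tfrac12\log j(\gamma,z)+\pi iS(\gamma)$ with $S(\gamma)$ real. $H(\gamma)=-S(\gamma)+A\frac{a_\gamma+d_\gamma}{c_\gamma}-\frac14\mathrm{sgn}(c_\gamma)$ if $c_\gamma\neq0$; $H(\gamma)=-S(\gamma)+A\frac{b_\gamma}{d_\gamma}+\frac14(\mathrm{sgn}(d_\gamma)-1)$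 if $c_\gamma=0$. Higher-order setting (positive genus): $f\in S_2(\Gamma)$ nonzero, Petersson norm $\|f\|$, modular symbol $\langle\gamma,f\rangle=2\pi i\int_{z_0}^{\gamma z_0}f(w)dw$ (independent of $z_0$, additive in $\gamma$, zero on elliptic and parabolic elements), $V_f=V_\Gamma/(16\pi^2\|f\|^2)$. $S^*$ is the higher-order modular Dedekind symbol of Jorgenson–O'Sullivan–Smajlović, defined via the Kronecker limit at $s=1$ of $E^{m,m}_\infty(z,s;f)=\sum_{\gamma\in\Gamma_\infty\backslash\Gamma}|\langle\gamma,f\rangle|^{2m}\mathrm{Im}(\gamma z)^s$: there is $\eta^*$ with $\log\eta^*(\gamma z)=\log\eta^*(z)+\tfrac12\log j(\gamma,z)+\pi iS^*(\gamma)$. $\theta=S^*-S$ satisfies $\theta(\gamma\tau)=\theta(\gamma)+\theta(\tau)+\frac{V_f}{2\pi}\mathrm{Im}(\langle\gamma,f\rangle\overline{\langle\tau,f\rangle})$. $H^*(\gamma)=\theta(\gamma)+A\frac{a_\gamma+d_\gamma}{c_\gamma}$ if $c_\gamma\ne0$, $\theta(\gamma)+A\frac{b_\gamma}{d_\gamma}$ if $c_\gamma=0$.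
   Formalization: The law of S* gets the extra term −(V_f/4)(2·conj⟨γ,f⟩F(z)+|⟨γ,f⟩|²), F(z)=2πi∫_{i∞}^z f(w)dw; without it θ would be additive, contradicting the stated cocycle relation, which is proved here from the corrected law. *)

theory Defs
  imports "HOL-Complex_Analysis.Complex_Analysis" "HOL-Algebra.Generated_Groups"
begin

definition upper_half_plane :: "complex set" where
  "upper_half_plane = {z. Im z > 0}"

definition SL2R :: "(real^2^2) monoid" where
  "SL2R = \<lparr>carrier = {M. det M = 1}, mult = (**), one = mat 1\<rparr>"

abbreviation entry_a :: "real^2^2 \<Rightarrow> real" where "entry_a M \<equiv> M $ 1 $ 1"
abbreviation entry_b :: "real^2^2 \<Rightarrow> real" where "entry_b M \<equiv> M $ 1 $ 2"
abbreviation entry_c :: "real^2^2 \<Rightarrow> real" where "entry_c M \<equiv> M $ 2 $ 1"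
abbreviation entry_d :: "real^2^2 \<Rightarrow> real" where "entry_d M \<equiv> M $ 2 $ 2"

definition autj :: "real^2^2 \<Rightarrow> complex \<Rightarrow> complex" where
  "autj M z = of_real (entry_c M) * z + of_real (entry_d M)"

definition mobius :: "real^2^2 \<Rightarrow> complex \<Rightarrow> complex" where
  "mobius M z = (of_real (entry_a M) * z + of_real (entry_b M)) / autj M z"

definition translation :: "real \<Rightarrow> real^2^2" where
  "translation h = vector [vector [1, h], vector [0, 1]]"


subsection \<open>Fuchsian groups of the first kind with a normalized cusp at infinity\<close>

definition hyperbolic_measure :: "complex measure" where
  "hyperbolic_measure =
     density lborel (\<lambda>z. ennreal (indicator upper_half_plane z / (Im z)\<^sup>2))"

definition fundamental_set :: "(real^2^2) set \<Rightarrow> complex set \<Rightarrow> bool" where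
  "fundamental_set \<Gamma> F \<longleftrightarrow>
     F \<in> sets borel \<and> F \<subseteq> upper_half_plane \<and>
     (\<forall>z\<in>upper_half_plane. \<exists>!w. w \<in> F \<and> (\<exists>\<gamma>\<in>\<Gamma>. w = mobius \<gamma> z))"

definition cofinite_area :: "(real^2^2) set \<Rightarrow> bool" where
  "cofinite_area \<Gamma> \<longleftrightarrow> (\<exists>F. fundamental_set \<Gamma> F \<and> emeasure hyperbolic_measure F < \<infinity>)"

text \<open>Integrals of invariant functions over the quotient are computed on a Borel set of orbit
  representatives. Any two such sets give the same value, because the hyperbolic measure is
  invariant under the group, so the choice made here is immaterial.\<close>

definition quotient_domain :: "(real^2^2) set \<Rightarrow> complex set" where
  "quotient_domain \<Gamma> =
     (SOME F. fundamental_set \<Gamma> F \<and> emeasure hyperbolic_measure F < \<infinity>)"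

definition covolume :: "(real^2^2) set \<Rightarrow> real" where
  "covolume \<Gamma> = measure hyperbolic_measure (quotient_domain \<Gamma>)"

definition stabilizer_infinity :: "(real^2^2) set \<Rightarrow> (real^2^2) set" where
  "stabilizer_infinity \<Gamma> = {\<gamma> \<in> \<Gamma>. entry_c \<gamma> = 0}"

definition normalized_fuchsian_first_kind :: "(real^2^2) set \<Rightarrow> bool" where
  "normalized_fuchsian_first_kind \<Gamma> \<longleftrightarrow>
     subgroup \<Gamma> SL2R \<and> discrete \<Gamma> \<and> cofinite_area \<Gamma> \<and>
     translation 1 \<in> \<Gamma> \<and>
     stabilizer_infinity \<Gamma> = generate SL2R ({translation 1} \<union> ({- mat 1} \<inter> \<Gamma>))"

definition A_const :: "(real^2^2) set \<Rightarrow> real" where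
  "A_const \<Gamma> = covolume \<Gamma> / (4 * pi)"


subsection \<open>The modular Dedekind symbol\<close>

definition cosets_infinity :: "(real^2^2) set \<Rightarrow> (real^2^2) set set" where
  "cosets_infinity \<Gamma> = rcosets\<^bsub>SL2R\<lparr>carrier := \<Gamma>\<rparr>\<^esub> (stabilizer_infinity \<Gamma>)"

definition eisenstein :: "(real^2^2) set \<Rightarrow> complex \<Rightarrow> complex \<Rightarrow> complex" where
  "eisenstein \<Gamma> z s =
     (\<Sum>\<^sub>\<infinity>C\<in>cosets_infinity \<Gamma>. of_real (Im (mobius (SOME \<gamma>. \<gamma> \<in> C) z)) powr s)"

text \<open>Kronecker limit formula: near \<open>s = 1\<close> the Eisenstein series is
  \<open>(1/V)/(s - 1) + B - (1/V) log (|\<eta>(z)|^4 Im z) + o(1)\<close>. The limit is taken inside the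
  half-plane where the series converges; it agrees with the limit of the meromorphic
  continuation. The constant \<open>B\<close> only rescales \<open>\<eta>\<close>.\<close>

definition kronecker_eta :: "(real^2^2) set \<Rightarrow> (complex \<Rightarrow> complex) \<Rightarrow> bool" where
  "kronecker_eta \<Gamma> \<eta> \<longleftrightarrow>
     \<eta> holomorphic_on upper_half_plane \<and>
     (\<forall>z\<in>upper_half_plane. \<eta> z \<noteq> 0) \<and>
     (\<exists>B::real. \<forall>z\<in>upper_half_plane.
        ((\<lambda>s. eisenstein \<Gamma> z s - of_real (1 / covolume \<Gamma>) / (s - 1))
           \<longlongrightarrow> of_real (B - 1 / covolume \<Gamma> * ln (cmod (\<eta> z) ^ 4 * Im z)))
          (at 1 within {s. Re s > 1}))"

definition holomorphic_log :: "(complex \<Rightarrow> complex) \<Rightarrow> (complex \<Rightarrow> complex) \<Rightarrow> bool" where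
  "holomorphic_log \<eta> L \<longleftrightarrow>
     L holomorphic_on upper_half_plane \<and> (\<forall>z\<in>upper_half_plane. exp (L z) = \<eta> z)"

definition modular_dedekind_symbol :: "(real^2^2) set \<Rightarrow> (real^2^2 \<Rightarrow> real) \<Rightarrow> bool" where
  "modular_dedekind_symbol \<Gamma> S \<longleftrightarrow>
     (\<exists>\<eta> L. kronecker_eta \<Gamma> \<eta> \<and> holomorphic_log \<eta> L \<and>
        (\<forall>\<gamma>\<in>\<Gamma>. \<forall>z\<in>upper_half_plane.
           L (mobius \<gamma> z) = L z + 1/2 * Ln (autj \<gamma> z) + of_real pi * \<i> * of_real (S \<gamma>)))"

definition H_symbol :: "(real^2^2) set \<Rightarrow> (real^2^2 \<Rightarrow> real) \<Rightarrow> real^2^2 \<Rightarrow> real" where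
  "H_symbol \<Gamma> S \<gamma> =
     (if entry_c \<gamma> \<noteq> 0
      then - S \<gamma> + A_const \<Gamma> * ((entry_a \<gamma> + entry_d \<gamma>) / entry_c \<gamma>) - 1/4 * sgn (entry_c \<gamma>)
      else - S \<gamma> + A_const \<Gamma> * (entry_b \<gamma> / entry_d \<gamma>) + 1/4 * (sgn (entry_d \<gamma>) - 1))"


subsection \<open>Weight two cusp forms and modular symbols\<close>

text \<open>The point \<open>\<sigma>\<infinity>\<close> is a cusp iff the group contains, up to sign, a conjugate
  \<open>\<sigma> (translation h) \<sigma>\<^sup>-\<^sup>1\<close> with \<open>h \<noteq> 0\<close>. The form slashed by \<open>\<sigma>\<close> is then \<open>h\<close>-periodic, and its
  vanishing at \<open>\<i>\<infinity>\<close> says exactly that its Fourier expansion has only positive frequencies.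
  A nonzero form in this space is a nonzero holomorphic differential on the compactified quotient,
  which therefore has positive genus.\<close>

definition cusp_forms_weight2 :: "(real^2^2) set \<Rightarrow> (complex \<Rightarrow> complex) set" where
  "cusp_forms_weight2 \<Gamma> = {f.
     f holomorphic_on upper_half_plane \<and>
     (\<forall>\<gamma>\<in>\<Gamma>. \<forall>z\<in>upper_half_plane. f (mobius \<gamma> z) = autj \<gamma> z ^ 2 * f z) \<and>
     (\<forall>\<sigma>\<in>carrier SL2R.
        (\<exists>h. h \<noteq> 0 \<and> (\<sigma> ** translation h ** matrix_inv \<sigma> \<in> \<Gamma> \<or>
                      - (\<sigma> ** translation h ** matrix_inv \<sigma>) \<in> \<Gamma>)) \<longrightarrow>
        ((\<lambda>z. f (mobius \<sigma> z) / autj \<sigma> z ^ 2) \<longlongrightarrow> 0) (filtercomap Im at_top))}"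

definition petersson_norm :: "(real^2^2) set \<Rightarrow> (complex \<Rightarrow> complex) \<Rightarrow> real" where
  "petersson_norm \<Gamma> f =
     sqrt (LINT z:quotient_domain \<Gamma>|hyperbolic_measure. (Im z)\<^sup>2 * (cmod (f z))\<^sup>2)"

definition V_form :: "(real^2^2) set \<Rightarrow> (complex \<Rightarrow> complex) \<Rightarrow> real" where
  "V_form \<Gamma> f = covolume \<Gamma> / (16 * pi\<^sup>2 * (petersson_norm \<Gamma> f)\<^sup>2)"

text \<open>The modular symbol is independent of the base point, here \<open>\<i>\<close>.\<close>

definition modular_symbol :: "(complex \<Rightarrow> complex) \<Rightarrow> real^2^2 \<Rightarrow> complex" where
  "modular_symbol f \<gamma> =
     2 * of_real pi * \<i> * contour_integral (linepath \<i> (mobius \<gamma> \<i>)) f"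

text \<open>The primitive \<open>2\<pi>\<i> \<integral> f(w) dw\<close> from \<open>\<i>\<infinity>\<close> to \<open>z\<close>, along a vertical ray.\<close>

definition cusp_primitive :: "(complex \<Rightarrow> complex) \<Rightarrow> complex \<Rightarrow> complex" where
  "cusp_primitive f z =
     Lim at_top (\<lambda>T::real.
       2 * of_real pi * \<i> * contour_integral (linepath (z + \<i> * of_real T) z) f)"


subsection \<open>The higher-order modular Dedekind symbol\<close>

definition higher_eisenstein ::
    "(real^2^2) set \<Rightarrow> (complex \<Rightarrow> complex) \<Rightarrow> nat \<Rightarrow> complex \<Rightarrow> complex \<Rightarrow> complex" where
  "higher_eisenstein \<Gamma> f m z s =
     (\<Sum>\<^sub>\<infinity>C\<in>cosets_infinity \<Gamma>.
        let \<gamma> = (SOME \<gamma>. \<gamma> \<in> C)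
        in of_real (cmod (modular_symbol f \<gamma>) ^ (2 * m)) * of_real (Im (mobius \<gamma> z)) powr s)"

text \<open>The twisted series has a pole of order \<open>m + 1\<close> at \<open>s = 1\<close> with leading coefficient
  \<open>(m!)\<^sup>2 / (V V_f^m)\<close>; the second Laurent coefficient, suitably scaled, defines \<open>\<eta>\<^sup>*\<close>.\<close>

definition kronecker_eta_star ::
    "(real^2^2) set \<Rightarrow> (complex \<Rightarrow> complex) \<Rightarrow> nat \<Rightarrow> (complex \<Rightarrow> complex) \<Rightarrow> bool" where
  "kronecker_eta_star \<Gamma> f m \<eta> \<longleftrightarrow>
     \<eta> holomorphic_on upper_half_plane \<and>
     (\<forall>z\<in>upper_half_plane. \<eta> z \<noteq> 0) \<and>
     (\<exists>B::real. \<forall>z\<in>upper_half_plane.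
        ((\<lambda>s. of_real (V_form \<Gamma> f ^ m / (fact m)\<^sup>2) * (s - 1) ^ m * higher_eisenstein \<Gamma> f m z s
               - of_real (1 / covolume \<Gamma>) / (s - 1))
           \<longlongrightarrow> of_real (B - 1 / covolume \<Gamma> * ln (cmod (\<eta> z) ^ 4 * Im z)))
          (at 1 within {s. Re s > 1}))"

text \<open>Because the twisted series is not invariant under the group, \<open>|\<eta>\<^sup>*|^4 Im z\<close> is not
  invariant either: replacing \<open>z\<close> by \<open>\<gamma>z\<close> changes its logarithm by
  \<open>|F(z)|\<^sup>2 - |F(\<gamma>z)|\<^sup>2\<close> times \<open>V_f\<close>, where \<open>F\<close> is the cusp primitive and
  \<open>F(\<gamma>z) = F(z) + \<langle>\<gamma>,f\<rangle>\<close>. The holomorphic function with that real part is the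
  \<open>V_f\<close>-term below. Without it, a real \<open>S\<^sup>*\<close> would force \<open>S\<^sup>* - S\<close> to be additive,
  contradicting the cocycle relation of \<open>S\<^sup>* - S\<close>.\<close>

definition higher_dedekind_symbol ::
    "(real^2^2) set \<Rightarrow> (complex \<Rightarrow> complex) \<Rightarrow> nat \<Rightarrow> (real^2^2 \<Rightarrow> real) \<Rightarrow> bool" where
  "higher_dedekind_symbol \<Gamma> f m S \<longleftrightarrow>
     (\<exists>\<eta> L. kronecker_eta_star \<Gamma> f m \<eta> \<and> holomorphic_log \<eta> L \<and>
        (\<forall>\<gamma>\<in>\<Gamma>. \<forall>z\<in>upper_half_plane.
           L (mobius \<gamma> z) = L z + 1/2 * Ln (autj \<gamma> z) + of_real pi * \<i> * of_real (S \<gamma>)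
             - of_real (V_form \<Gamma> f / 4) *
               (2 * cnj (modular_symbol f \<gamma>) * cusp_primitive f z
                + of_real ((cmod (modular_symbol f \<gamma>))\<^sup>2))))"

definition H_star :: "(real^2^2) set \<Rightarrow> (real^2^2 \<Rightarrow> real) \<Rightarrow> real^2^2 \<Rightarrow> real" where
  "H_star \<Gamma> \<theta> \<gamma> =
     (if entry_c \<gamma> \<noteq> 0
      then \<theta> \<gamma> + A_const \<Gamma> * ((entry_a \<gamma> + entry_d \<gamma>) / entry_c \<gamma>)
      else \<theta> \<gamma> + A_const \<Gamma> * (entry_b \<gamma> / entry_d \<gamma>))"

end

theory Submission
  imports Defs "HOL-Real_Asymp.Real_Asymp"
begin

text \<open>Both identities come from evaluating a transformation law at \<open>(\<gamma> \<tau>) \<i> = \<gamma> (\<tau> \<i>)\<close> in two ways.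
  For \<open>S\<close> the defect of additivity is the branch jump of \<open>Ln\<close> for
  \<open>j(\<gamma>\<tau>, z) = j(\<gamma>, \<tau> z) j(\<tau>, z)\<close>, and the signs of the imaginary parts of the three factors are the
  signs of the lower left entries. For \<open>\<theta> = S\<^sup>* - S\<close> the logarithms cancel and the cusp primitive
  \<open>F\<close> contributes the defect through \<open>F(\<gamma> z) = F(z) + \<langle>\<gamma>, f\<rangle>\<close>.\<close>

section \<open>Moebius action and automorphy factor on the upper half-plane\<close>

lemma upper_half_plane_iff [simp]: "z \<in> upper_half_plane \<longleftrightarrow> Im z > 0"
  by (simp add: upper_half_plane_def)

lemma open_upper_half_plane: "open upper_half_plane"
  by (simp add: upper_half_plane_def open_halfspace_Im_gt)

lemma convex_upper_half_plane: "convex upper_half_plane"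
  by (simp add: upper_half_plane_def convex_halfspace_Im_gt)

lemma entries_matrix_mult:
  fixes M N :: "real^2^2"
  shows "(M ** N) $ i $ j = M $ i $ 1 * N $ 1 $ j + M $ i $ 2 * N $ 2 $ j"
  by (simp add: matrix_matrix_mult_def sum_2)

lemma autj_nonzero:
  assumes "det M = 1" "Im z > 0"
  shows "autj M z \<noteq> 0"
proof
  assume "autj M z = 0"
  then have "entry_c M * Im z = 0" "entry_c M * Re z + entry_d M = 0"
    by (simp_all add: autj_def complex_eq_iff)
  then have "entry_c M = 0" "entry_d M = 0"
    using assms(2) by auto
  then show False
    using assms(1) by (simp add: det_2)
qed

lemma Im_mobius:
  assumes "det M = 1"
  shows "Im (mobius M z) = Im z / (cmod (autj M z))\<^sup>2"
proof -
  have "entry_a M * Im z * (entry_c M * Re z + entry_d M)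
          - (entry_a M * Re z + entry_b M) * (entry_c M * Im z) = det M * Im z"
    by (simp add: det_2 algebra_simps)
  then show ?thesis
    using assms by (simp add: mobius_def autj_def Im_divide cmod_power2)
qed

lemma Im_mobius_pos:
  assumes "det M = 1" "Im z > 0"
  shows "Im (mobius M z) > 0"
  using assms autj_nonzero[OF assms] by (simp add: Im_mobius)

lemma autj_mult:
  assumes "det N = 1" "Im z > 0"
  shows "autj (M ** N) z = autj M (mobius N z) * autj N z"
  using autj_nonzero[OF assms]
  by (simp add: autj_def[of M] autj_def[of "M ** N"] mobius_def entries_matrix_mult field_simps)
     (simp add: autj_def algebra_simps)

lemma mobius_mult:
  assumes "det N = 1" "Im z > 0"
  shows "mobius (M ** N) z = mobius M (mobius N z)"
proof -
  have nz: "autj N z \<noteq> 0"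
    by (rule autj_nonzero[OF assms])
  have "mobius M (mobius N z) =
          (entry_a M * mobius N z + entry_b M) * autj N z / (autj M (mobius N z) * autj N z)"
    using nz by (simp add: mobius_def[of M])
  also have "(entry_a M * mobius N z + entry_b M) * autj N z =
          entry_a (M ** N) * z + entry_b (M ** N)"
    using nz by (simp add: mobius_def entries_matrix_mult field_simps)
      (simp add: autj_def algebra_simps)
  finally show ?thesis
    by (simp add: mobius_def[of "M ** N"] autj_mult[OF assms])
qed

lemma mobius_has_field_derivative:
  assumes "det M = 1" "Im z > 0"
  shows "(mobius M has_field_derivative 1 / (autj M z)\<^sup>2) (at z)"
proof -
  have nz: "autj M z \<noteq> 0"
    by (rule autj_nonzero[OF assms])
  have det: "of_real (entry_a M) * of_real (entry_d M)
               - of_real (entry_b M) * of_real (entry_c M) = (1 :: complex)"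
    using arg_cong[OF assms(1), of complex_of_real] by (simp add: det_2)
  have "((\<lambda>z. (entry_a M * z + entry_b M) / (entry_c M * z + entry_d M)) has_field_derivative
          (entry_a M * (entry_c M * z + entry_d M) - (entry_a M * z + entry_b M) * entry_c M)
            / (entry_c M * z + entry_d M)\<^sup>2) (at z)"
    using nz by (auto intro!: derivative_eq_intros simp: autj_def power2_eq_square)
  also have "entry_a M * (entry_c M * z + entry_d M) - (entry_a M * z + entry_b M) * entry_c M = 1"
    using det by (simp add: algebra_simps)
  finally show ?thesis
    by (simp add: mobius_def[abs_def] autj_def[abs_def])
qed

section \<open>Branch defect of the logarithm and quasi-additivity of \<open>S\<close>\<close>

text \<open>The sign of \<open>Im w\<close> places the argument of \<open>w\<close> in (0, pi) or
  (-pi, 0). The defect is 2 pi \<open>\<i>\<close> if \<open>x\<close>, \<open>y\<close> lie above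
  the real axis and \<open>x * y\<close> below, -2 pi \<open>\<i>\<close> in the mirrored case, and
  0 otherwise; the sign expression takes the values 4, -4 and 0 accordingly.\<close>

lemma Ln_mult_sgn_Im:
  assumes "Im x \<noteq> 0" "Im y \<noteq> 0" "Im (x * y) \<noteq> 0"
  shows "Ln x + Ln y - Ln (x * y) =
    of_real (pi / 2 * (sgn (Im x) + sgn (Im y) - sgn (Im (x * y))
                        - sgn (Im x * Im y * Im (x * y)))) * \<i>"
proof -
  have arg: "(Im w > 0 \<and> 0 < Im (Ln w) \<and> Im (Ln w) < pi) \<or>
             (Im w < 0 \<and> - pi < Im (Ln w) \<and> Im (Ln w) < 0)" if "Im w \<noteq> 0" for w
  proof -
    have "w \<noteq> 0"
      using that by auto
    then show ?thesis
      using that Im_Ln_pos_lt[of w] Im_Ln_pos_le[of w] mpi_less_Im_Ln[of w] Im_Ln_le_pi[of w]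
      by linarith
  qed
  have nz: "x \<noteq> 0" "y \<noteq> 0"
    using assms by auto
  note Ln = Ln_times[OF nz]
  have ImLn: "Im (Ln (x * y)) =
     (if Im (Ln x + Ln y) \<le> - pi then Im (Ln x) + Im (Ln y) + 2 * pi
      else if Im (Ln x + Ln y) > pi then Im (Ln x) + Im (Ln y) - 2 * pi
      else Im (Ln x) + Im (Ln y))"
    by (simp add: Ln)
  show ?thesis
    using arg[OF assms(1)] arg[OF assms(2)] arg[OF assms(3)] ImLn
    unfolding Ln by (auto simp: sgn_mult split: if_splits)
qed

lemma det_normalized_fuchsian:
  assumes "normalized_fuchsian_first_kind \<Gamma>" "g \<in> \<Gamma>"
  shows "det g = 1"
  using assms subgroup.subset[of \<Gamma> SL2R]
  by (auto simp: normalized_fuchsian_first_kind_def SL2R_def)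

lemma mult_normalized_fuchsian:
  assumes "normalized_fuchsian_first_kind \<Gamma>" "g \<in> \<Gamma>" "h \<in> \<Gamma>"
  shows "g ** h \<in> \<Gamma>"
  using assms subgroup.m_closed[of \<Gamma> SL2R g h]
  by (auto simp: normalized_fuchsian_first_kind_def SL2R_def)

lemma modular_dedekind_symbol_mult:
  assumes fuchsian: "normalized_fuchsian_first_kind \<Gamma>"
    and symbol: "modular_dedekind_symbol \<Gamma> S"
    and \<gamma>: "\<gamma> \<in> \<Gamma>" and \<tau>: "\<tau> \<in> \<Gamma>"
    and c: "entry_c \<gamma> * entry_c \<tau> * entry_c (\<gamma> ** \<tau>) \<noteq> 0"
  shows "S (\<gamma> ** \<tau>) = S \<gamma> + S \<tau> + 1/4 * (sgn (entry_c \<gamma>) + sgn (entry_c \<tau>)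
           - sgn (entry_c (\<gamma> ** \<tau>)) - sgn (entry_c \<gamma> * entry_c \<tau> * entry_c (\<gamma> ** \<tau>)))"
proof -
  obtain L where L: "\<And>g z. g \<in> \<Gamma> \<Longrightarrow> Im z > 0 \<Longrightarrow>
      L (mobius g z) = L z + 1/2 * Ln (autj g z) + of_real pi * \<i> * of_real (S g)"
    using symbol
    unfolding modular_dedekind_symbol_def Ball_def upper_half_plane_iff by blast
  have det: "det \<tau> = 1"
    using det_normalized_fuchsian[OF fuchsian \<tau>] .
  define w where "w = mobius \<tau> \<i>"
  have w: "Im w > 0"
    by (simp add: w_def Im_mobius_pos[OF det])
  define x where "x = autj \<gamma> w"
  define y where "y = autj \<tau> \<i>"
  have xy: "autj (\<gamma> ** \<tau>) \<i> = x * y"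
    by (simp add: x_def y_def w_def autj_mult[OF det])
  \<comment> \<open>At the base point \<open>\<i>\<close> the imaginary part of an automorphy factor
    is exactly the lower left entry; at \<open>w\<close> it is that entry times the positive number
    \<open>Im w\<close>, which leaves the sign unchanged.\<close>
  have Imxy: "Im (x * y) = entry_c (\<gamma> ** \<tau>)"
    by (simp flip: xy add: autj_def)
  have Imx: "Im x = entry_c \<gamma> * Im w" and Imy: "Im y = entry_c \<tau>"
    by (simp_all add: x_def y_def autj_def)
  have "L (mobius (\<gamma> ** \<tau>) \<i>) = L (mobius \<gamma> w)"
    by (simp add: w_def mobius_mult[OF det])
  then have "of_real pi * \<i> * (of_real (S (\<gamma> ** \<tau>)) - of_real (S \<gamma>) - of_real (S \<tau>)) =
      1/2 * (Ln x + Ln y - Ln (x * y))"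
    using L[OF mult_normalized_fuchsian[OF fuchsian \<gamma> \<tau>], of \<i>] L[OF \<gamma> w] L[OF \<tau>, of \<i>]
    by (simp add: xy x_def[symmetric] y_def[symmetric] w_def[symmetric] algebra_simps)
  \<comment> \<open>The factor pi/2 here and the 1/2 in front of the logarithms give pi/4, so
    dividing by pi leaves the coefficient 1/4.\<close>
  also have "Ln x + Ln y - Ln (x * y) =
    of_real (pi / 2 * (sgn (Im x) + sgn (Im y) - sgn (Im (x * y))
                        - sgn (Im x * Im y * Im (x * y)))) * \<i>"
    using c w by (intro Ln_mult_sgn_Im) (auto simp: Imx Imy Imxy simp del: times_complex.sel)
  also have "sgn (Im x) = sgn (entry_c \<gamma>)"
    using w by (simp add: Imx sgn_mult)
  also have "sgn (Im x * Im y * Im (x * y)) = sgn (entry_c \<gamma> * entry_c \<tau> * entry_c (\<gamma> ** \<tau>))"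
    using w unfolding Imx Imy Imxy by (simp add: sgn_mult)
  finally show ?thesis
    unfolding Imy Imxy by (simp add: complex_eq_iff) (simp add: field_simps)
qed

section \<open>Decay at the cusp and convergence of a periodic primitive\<close>

lemma Im_closed_segment_eq:
  assumes "w \<in> closed_segment a b" "Im a = y" "Im b = y"
  shows "Im w = y"
proof -
  obtain u where "w = (1 - u) *\<^sub>R a + u *\<^sub>R b"
    using assms(1) by (auto simp: in_segment)
  then show ?thesis
    using assms(2,3) by (simp add: left_diff_distrib)
qed

text \<open>Since the primitive is periodic, \<open>f\<close> has mean zero over a period, so \<open>f\<close> is bounded by the
  oscillation over a period, hence by its derivative; Cauchy's inequality then gains a factor
  \<open>1 / Im z\<close>. Two steps make \<open>f\<close> integrable along vertical rays, without a Fourier expansion.\<close>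

lemma periodic_primitive_decay_step:
  fixes f G :: "complex \<Rightarrow> complex"
  assumes G: "\<And>z. Im z > 0 \<Longrightarrow> (G has_field_derivative f z) (at z)"
    and periodic: "\<And>z. Im z > 0 \<Longrightarrow> G (z + 1) = G z"
    and hol: "f holomorphic_on upper_half_plane"
    and "Y > 0" "B \<ge> 0"
    and bound: "\<And>z. Im z > Y \<Longrightarrow> cmod (f z) \<le> B / Im z ^ k"
    and z: "Im z > 2 * Y"
  shows "cmod (f z) \<le> (2 ^ Suc k * B) / Im z ^ Suc k"
proof -
  define y where "y = Im z"
  have y: "y > 0" "y / 2 > Y"
    using z \<open>Y > 0\<close> by (simp_all add: y_def)
  \<comment> \<open>Cauchy's bound for \<open>deriv f\<close> at height \<open>y\<close> on a disc
    of radius \<open>y / 2\<close>: the disc stays at height at least \<open>y / 2 > Y\<close>,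
    where \<open>f\<close> is at most \<open>B / (y / 2) ^ k\<close>, and dividing by the radius
    gives \<open>D\<close>.\<close>
  define D where "D = (2 ^ Suc k * B) / y ^ Suc k"
  have deriv: "cmod (deriv f w) \<le> D" if w: "Im w = y" for w
  proof -
    have Im: "Im x \<ge> y / 2" if "x \<in> cball w (y / 2)" for x
      using that w abs_Im_le_cmod[of "w - x"] by (simp add: dist_norm)
    have sub: "cball w (y / 2) \<subseteq> upper_half_plane"
      using Im y by force
    have "cmod ((deriv ^^ 1) f w) \<le> fact 1 * (B / (y / 2) ^ k) / (y / 2) ^ 1"
    proof (rule Cauchy_inequality)
      show "f holomorphic_on ball w (y / 2)"
        using hol sub ball_subset_cball holomorphic_on_subset by blast
      show "continuous_on (cball w (y / 2)) f"
        using hol sub holomorphic_on_imp_continuous_on continuous_on_subset by blast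
      show "y / 2 > 0"
        using y by simp
      fix x assume "cmod (w - x) = y / 2"
      then have Imx: "Im x \<ge> y / 2"
        by (intro Im) (simp add: dist_norm)
      then have "cmod (f x) \<le> B / Im x ^ k"
        using y by (intro bound) simp
      also have "\<dots> \<le> B / (y / 2) ^ k"
        using Imx y \<open>B \<ge> 0\<close> by (intro divide_left_mono power_mono mult_pos_pos zero_less_power) auto
      finally show "cmod (f x) \<le> B / (y / 2) ^ k" .
    qed
    also have "fact 1 * (B / (y / 2) ^ k) / (y / 2) ^ 1 = D"
      using y by (simp add: D_def power_divide field_simps)
    finally show ?thesis
      by simp
  qed
  have "D \<ge> 0"
    using deriv[of z] norm_ge_zero order_trans unfolding y_def by blast
  have segment_Im: "Im w = y" if "w \<in> closed_segment z (z + 1)" for w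
    using Im_closed_segment_eq[OF that] by (simp add: y_def)
  have segment_dist: "cmod (w - z) \<le> 1" if "w \<in> closed_segment z (z + 1)" for w
    using segment_bound(1)[OF that] by simp
  have f_deriv: "(f has_field_derivative deriv f w) (at w within T)" if "Im w = y" for w T
    using that y hol open_upper_half_plane
    by (intro has_field_derivative_at_within[OF holomorphic_derivI[of f upper_half_plane]]) auto
  have osc: "cmod (f w - f z) \<le> D" if w: "w \<in> closed_segment z (z + 1)" for w
  proof -
    have "cmod (f w - f z) \<le> D * cmod (w - z)"
      by (rule field_differentiable_bound[of "closed_segment z (z + 1)" f "deriv f"])
        (use w in \<open>auto intro!: f_deriv deriv segment_Im\<close>)
    also have "\<dots> \<le> D"
      using \<open>D \<ge> 0\<close> segment_dist[OF w] by (simp add: mult_left_le)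
    finally show ?thesis .
  qed
  \<comment> \<open>The function \<open>G w - f z * w\<close> has derivative
    \<open>f w - f z\<close>, which is at most \<open>D\<close> on the unit segment. Periodicity
    cancels the two values of \<open>G\<close>, so the increment is just
    \<open>- f z\<close>.\<close>
  have "cmod ((G (z + 1) - f z * (z + 1)) - (G z - f z * z)) \<le> D * cmod ((z + 1) - z)"
  proof (rule field_differentiable_bound[of "closed_segment z (z + 1)" _ "\<lambda>w. f w - f z"])
    fix w assume w: "w \<in> closed_segment z (z + 1)"
    then have "Im w > 0"
      using segment_Im y by simp
    then show "((\<lambda>w. G w - f z * w) has_field_derivative f w - f z)
                 (at w within closed_segment z (z + 1))"
      by (auto intro!: derivative_eq_intros has_field_derivative_at_within[OF G])
    show "cmod (f w - f z) \<le> D"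
      by (rule osc[OF w])
  qed auto
  then show ?thesis
    using periodic[of z] y by (simp add: algebra_simps D_def y_def)
qed

text \<open>Since \<open>f\<close> decays like 1/y^2, \<open>G\<close> is Cauchy along the imaginary
  axis, and moving horizontally at height \<open>t\<close> costs at most the distance times 8/t^2.
  Hence all vertical rays share one limit \<open>l\<close>; its independence of \<open>z\<close>
  makes it cancel in differences of the cusp primitive.\<close>

lemma periodic_primitive_convergent:
  fixes f G :: "complex \<Rightarrow> complex"
  assumes G: "\<And>z. Im z > 0 \<Longrightarrow> (G has_field_derivative f z) (at z)"
    and periodic: "\<And>z. Im z > 0 \<Longrightarrow> G (z + 1) = G z"
    and hol: "f holomorphic_on upper_half_plane"
    and lim: "(f \<longlongrightarrow> 0) (filtercomap Im at_top)"
  obtains l where "\<And>z. ((\<lambda>T. G (z + \<i> * of_real T)) \<longlongrightarrow> l) at_top"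
proof -
  have "eventually (\<lambda>z. cmod (f z) < 1) (filtercomap Im at_top)"
    using tendstoD[OF lim, of 1] by simp
  then obtain Y0 where Y0: "\<And>z. Im z > Y0 \<Longrightarrow> cmod (f z) < 1"
    by (auto simp: eventually_filtercomap_at_top_dense)
  define Y where "Y = max 1 Y0"
  have Y: "Y > 0" by (simp add: Y_def)
  \<comment> \<open>The decay step runs from \<open>k = 0\<close>, \<open>B = 1\<close> to
    \<open>k = 1\<close>, \<open>B = 2\<close>, and then to \<open>k = 2\<close>,
    \<open>B = 2^2 * 2 = 8\<close>. Each step doubles the height from which the bound holds.\<close>
  have b0: "cmod (f z) \<le> 1 / Im z ^ 0" if "Im z > Y" for z
    using Y0[of z] that by (simp add: Y_def less_imp_le)
  have b1: "cmod (f z) \<le> 2 / Im z ^ 1" if "Im z > 2 * Y" for z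
    using periodic_primitive_decay_step[OF G periodic hol Y _ b0 that] by simp
  have b2: "cmod (f z) \<le> 8 / (Im z)\<^sup>2" if "Im z > 4 * Y" for z
    using periodic_primitive_decay_step[where Y = "2 * Y" and z = z, OF G periodic hol _ _ b1] that Y by (simp add: numeral_2_eq_2)
  \<comment> \<open>The majorant 8/u^2 has primitive -8/u. The mean value inequality is applied on a
    nondegenerate interval, so \<open>s = t\<close> is treated apart.\<close>
  have vertical: "cmod (G (of_real x + \<i> * of_real t) - G (of_real x + \<i> * of_real s)) \<le> 8 / s"
    if st: "4 * Y < s" "s \<le> t" for x s t :: real
  proof (cases "s = t")
    case False
    have "cmod (G (of_real x + \<i> * of_real t) - G (of_real x + \<i> * of_real s))
            \<le> - 8 / t - - 8 / s"
    proof (rule differentiable_bound_general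
        [where f = "\<lambda>u. G (of_real x + \<i> * of_real u)" and \<phi> = "\<lambda>u. - 8 / u"
           and f' = "\<lambda>u. f (of_real x + \<i> * of_real u) * \<i>" and \<phi>' = "\<lambda>u. 8 / u\<^sup>2"])
      show "s < t" using st False by simp
      have D: "((\<lambda>u. G (of_real x + \<i> * of_real u)) has_vector_derivative
              f (of_real x + \<i> * of_real u) * \<i>) (at u)" if "u \<ge> s" for u
      proof -
        have u: "u > 0" using that st Y by linarith
        have "((\<lambda>u. of_real x + \<i> * of_real u) has_vector_derivative \<i>) (at u)"
          by (auto intro!: derivative_eq_intros)
        from field_vector_diff_chain_at[OF this G] u show ?thesis
          by (simp add: o_def mult.commute)
      qed
      show "continuous_on {s..t} (\<lambda>u. G (of_real x + \<i> * of_real u))"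
        by (intro continuous_at_imp_continuous_on ballI has_vector_derivative_continuous[OF D]) simp
      show "continuous_on {s..t} (\<lambda>u. - 8 / u)"
        using st Y by (intro continuous_intros) auto
      fix u assume u: "s < u" "u < t"
      then show "((\<lambda>u. G (of_real x + \<i> * of_real u)) has_vector_derivative
              f (of_real x + \<i> * of_real u) * \<i>) (at u)"
        by (intro D) simp
      have "u > 0" using u st Y by linarith
      then show "((\<lambda>u. - 8 / u) has_vector_derivative 8 / u\<^sup>2) (at u)"
        by (auto intro!: derivative_eq_intros simp: power2_eq_square
            simp flip: has_real_derivative_iff_has_vector_derivative)
      show "norm (f (of_real x + \<i> * of_real u) * \<i>) \<le> 8 / u\<^sup>2"
        using b2[of "of_real x + \<i> * of_real u"] u st by (simp add: norm_mult)
    qed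
    also have "- 8 / t - - 8 / s \<le> 8 / s"
      using st Y by simp
    finally show ?thesis .
  qed (use st Y in simp)
  have horizontal: "cmod (G (of_real x + \<i> * of_real t) - G (\<i> * of_real t)) \<le> 8 / t\<^sup>2 * \<bar>x\<bar>"
    if t: "4 * Y < t" for x t :: real
  proof -
    have "cmod (G (of_real x + \<i> * of_real t) - G (\<i> * of_real t))
            \<le> 8 / t\<^sup>2 * cmod ((of_real x + \<i> * of_real t) - \<i> * of_real t)"
    proof (rule field_differentiable_bound
        [where f' = f and S = "closed_segment (of_real x + \<i> * of_real t) (\<i> * of_real t)"])
      fix w assume "w \<in> closed_segment (of_real x + \<i> * of_real t) (\<i> * of_real t)"
      then have w: "Im w = t"
        by (rule Im_closed_segment_eq) simp_all
      show "(G has_field_derivative f w)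
              (at w within closed_segment (of_real x + \<i> * of_real t) (\<i> * of_real t))"
        using w t Y by (intro has_field_derivative_at_within[OF G]) simp
      show "cmod (f w) \<le> 8 / t\<^sup>2"
        using b2[of w] w t by simp
    qed auto
    then show ?thesis by simp
  qed
  define g where "g = (\<lambda>n. G (\<i> * of_real (real n)))"
  have "Cauchy g"
  proof (rule metric_CauchyI)
    fix e :: real assume "e > 0"
    \<comment> \<open>Beyond \<open>4 * Y\<close> the vertical bound is available, and beyond
      \<open>16 / e\<close> it is below \<open>e / 2\<close>; the added 1 makes both inequalities
      strict.\<close>
    define N where "N = nat \<lceil>max (4 * Y) (16 / e)\<rceil> + 1"
    have N: "real N > 4 * Y" "real N > 16 / e"
      unfolding N_def by linarith+
    have "cmod (g n - g N) < e / 2" if "n \<ge> N" for n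
    proof -
      have "cmod (g n - g N) \<le> 8 / real N"
        using vertical[of "real N" "real n" 0] that N by (simp add: g_def)
      also have "\<dots> < e / 2"
        using N \<open>e > 0\<close> by (simp add: N_def field_simps)
      finally show ?thesis .
    qed
    then show "\<exists>M. \<forall>m\<ge>M. \<forall>n\<ge>M. dist (g m) (g n) < e"
      by (metis dist_norm dist_triangle_half_l)
  qed
  then obtain l where l: "g \<longlonglongrightarrow> l"
    using Cauchy_convergent convergent_def by blast
  \<comment> \<open>Letting \<open>n\<close> tend to infinity in the vertical bound passes from
    integer heights to all real heights \<open>t\<close>, with a rate.\<close>
  have G_l: "cmod (G (\<i> * of_real t) - l) \<le> 8 / t" if t: "4 * Y < t" for t
  proof -
    have "((\<lambda>n. cmod (G (\<i> * of_real t) - g n)) \<longlonglongrightarrow> cmod (G (\<i> * of_real t) - l))"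
      by (intro tendsto_intros l)
    moreover have "eventually (\<lambda>n. cmod (G (\<i> * of_real t) - g n) \<le> 8 / t) sequentially"
      using eventually_ge_at_top[of "nat \<lceil>t\<rceil>"]
    proof eventually_elim
      case (elim n)
      then have "t \<le> real n" by linarith
      then show ?case
        using vertical[of t "real n" 0] t by (simp add: g_def norm_minus_commute)
    qed
    ultimately show ?thesis
      by (rule tendsto_upperbound) simp
  qed
  have "((\<lambda>T. G (z + \<i> * of_real T)) \<longlongrightarrow> l) at_top" for z
  proof -
    \<comment> \<open>The first term pays for the horizontal move to the imaginary axis at height
      \<open>Im z + T\<close>, the second for the distance to \<open>l\<close> there.\<close>
    define b where "b = (\<lambda>T. 8 / (Im z + T)\<^sup>2 * \<bar>Re z\<bar> + 8 / (Im z + T))"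
    have "eventually (\<lambda>T. cmod (G (z + \<i> * of_real T) - l) \<le> b T) at_top"
      using eventually_gt_at_top[of "4 * Y - Im z"]
    proof eventually_elim
      case (elim T)
      have z: "z + \<i> * of_real T = of_real (Re z) + \<i> * of_real (Im z + T)"
        by (simp add: complex_eq_iff)
      have "cmod (G (z + \<i> * of_real T) - l) \<le>
          cmod (G (z + \<i> * of_real T) - G (\<i> * of_real (Im z + T)))
          + cmod (G (\<i> * of_real (Im z + T)) - l)"
        using norm_triangle_ineq[of "G (z + \<i> * of_real T) - G (\<i> * of_real (Im z + T))"
            "G (\<i> * of_real (Im z + T)) - l"] by simp
      also have "\<dots> \<le> b T"
        unfolding b_def z using elim by (intro add_mono horizontal G_l) simp_all
      finally show ?case .
    qed
    moreover have "(b \<longlongrightarrow> 0) at_top"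
      unfolding b_def by real_asymp
    ultimately have "((\<lambda>T. G (z + \<i> * of_real T) - l) \<longlongrightarrow> 0) at_top"
      by (rule Lim_null_comparison)
    then show ?thesis
      by (simp add: LIM_zero_iff)
  qed
  then show ?thesis
    by (rule that)
qed

section \<open>Primitives of cusp forms and modular symbols\<close>

lemma matrix_inv_mat_1: "matrix_inv (mat 1 :: real^2^2) = mat 1"
  by (simp add: matrix_inv_def)

text \<open>This is the cusp condition for \<open>\<sigma> = mat 1\<close> and \<open>h = 1\<close>,
  available because \<open>translation 1\<close> lies in the group.\<close>

lemma cusp_form_tendsto_0:
  assumes "normalized_fuchsian_first_kind \<Gamma>" "f \<in> cusp_forms_weight2 \<Gamma>"
  shows "(f \<longlongrightarrow> 0) (filtercomap Im at_top)"
proof -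
  have "mat 1 \<in> carrier SL2R"
    by (simp add: SL2R_def det_I)
  moreover have "\<exists>h. h \<noteq> 0 \<and> (mat 1 ** translation h ** matrix_inv (mat 1) \<in> \<Gamma> \<or>
                      - (mat 1 ** translation h ** matrix_inv (mat 1)) \<in> \<Gamma>)"
    using assms(1) by (intro exI[of _ 1]) (simp add: normalized_fuchsian_first_kind_def matrix_inv_mat_1)
  ultimately have "((\<lambda>z. f (mobius (mat 1) z) / autj (mat 1) z ^ 2) \<longlongrightarrow> 0) (filtercomap Im at_top)"
    using assms(2) unfolding cusp_forms_weight2_def by blast
  then show ?thesis
    by (simp add: mobius_def autj_def mat_def)
qed

text \<open>A primitive exists by convexity of the half-plane. The weight 2 factor cancels the
  derivative \<open>1 / (autj g z)\<^sup>2\<close> of the Moebius map, so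
  \<open>G (mobius g z) - G z\<close> has derivative zero and is constant in
  \<open>z\<close>.\<close>

lemma cusp_form_primitive:
  assumes fuchsian: "normalized_fuchsian_first_kind \<Gamma>" and f: "f \<in> cusp_forms_weight2 \<Gamma>"
  obtains G where "\<And>z. Im z > 0 \<Longrightarrow> (G has_field_derivative f z) (at z)"
    and "\<And>g z. g \<in> \<Gamma> \<Longrightarrow> Im z > 0 \<Longrightarrow> G (mobius g z) - G z = G (mobius g \<i>) - G \<i>"
proof -
  have "f holomorphic_on upper_half_plane"
    using f by (simp add: cusp_forms_weight2_def)
  then obtain G where
    "\<And>z. z \<in> upper_half_plane \<Longrightarrow> (G has_field_derivative f z) (at z within upper_half_plane)"
    using holomorphic_convex_primitive'[OF convex_upper_half_plane open_upper_half_plane] by metis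
  then have G: "(G has_field_derivative f z) (at z)" if "Im z > 0" for z
    using that open_upper_half_plane by (metis at_within_open upper_half_plane_iff)
  have "G (mobius g z) - G z = G (mobius g \<i>) - G \<i>" if g: "g \<in> \<Gamma>" and z: "Im z > 0" for g z
  proof -
    have det: "det g = 1"
      using det_normalized_fuchsian[OF fuchsian g] .
    have "((\<lambda>w. G (mobius g w) - G w) has_field_derivative 0) (at w within upper_half_plane)"
      if "w \<in> upper_half_plane" for w
    proof -
      have w: "Im w > 0"
        using that by simp
      have "f (mobius g w) = autj g w ^ 2 * f w"
        using f g that by (simp add: cusp_forms_weight2_def)
      then have "f (mobius g w) * (1 / (autj g w)\<^sup>2) - f w = 0"
        using autj_nonzero[OF det w] by simp
      moreover have "((\<lambda>w. G (mobius g w) - G w) has_field_derivative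
          f (mobius g w) * (1 / (autj g w)\<^sup>2) - f w) (at w)"
        by (intro DERIV_diff G w DERIV_chain2[OF G] mobius_has_field_derivative det
            Im_mobius_pos[OF det])
      ultimately have "((\<lambda>w. G (mobius g w) - G w) has_field_derivative 0) (at w)"
        by (simp only:)
      then show ?thesis
        by (rule has_field_derivative_at_within)
    qed
    then obtain c where "\<And>w. w \<in> upper_half_plane \<Longrightarrow> G (mobius g w) - G w = c"
      using has_field_derivative_zero_constant[OF convex_upper_half_plane,
          of "\<lambda>w. G (mobius g w) - G w"] by blast
    then show ?thesis
      using z by simp
  qed
  with G show ?thesis
    by (rule that)
qed

text \<open>What remains to be shown is periodicity of \<open>G\<close>. The constant
  \<open>G (z + 1) - G z\<close> is the integral of \<open>f\<close> over a horizontal unit segment,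
  which may be taken arbitrarily high, where \<open>f\<close> is small; so the constant
  vanishes.\<close>

lemma cusp_form_primitive_convergent:
  assumes fuchsian: "normalized_fuchsian_first_kind \<Gamma>" and f: "f \<in> cusp_forms_weight2 \<Gamma>"
    and G: "\<And>z. Im z > 0 \<Longrightarrow> (G has_field_derivative f z) (at z)"
    and inv: "\<And>g z. g \<in> \<Gamma> \<Longrightarrow> Im z > 0 \<Longrightarrow> G (mobius g z) - G z = G (mobius g \<i>) - G \<i>"
  obtains l where "\<And>z. ((\<lambda>T. G (z + \<i> * of_real T)) \<longlongrightarrow> l) at_top"
proof -
  have hol: "f holomorphic_on upper_half_plane"
    using f by (simp add: cusp_forms_weight2_def)
  have "translation 1 \<in> \<Gamma>"
    using fuchsian by (simp add: normalized_fuchsian_first_kind_def)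
  moreover have "mobius (translation 1) z = z + 1" for z
    by (simp add: mobius_def autj_def translation_def)
  ultimately have const: "G (z + 1) - G z = G (\<i> + 1) - G \<i>" if "Im z > 0" for z
    using inv[of "translation 1" z] that by simp
  have "cmod (G (\<i> + 1) - G \<i>) \<le> e" if "e > 0" for e
  proof -
    have "eventually (\<lambda>z. cmod (f z) < e) (filtercomap Im at_top)"
      using tendstoD[OF cusp_form_tendsto_0[OF fuchsian f] that] by simp
    then obtain Y where Y: "\<And>z. Im z > Y \<Longrightarrow> cmod (f z) < e"
      by (auto simp: eventually_filtercomap_at_top_dense)
    \<comment> \<open>The maximum with 0 keeps the point in the half-plane even when the threshold
      \<open>Y\<close> is negative.\<close>
    define z where "z = \<i> * of_real (max Y 0 + 1)"
    have z: "Im z > 0" "Im z > Y"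
      by (auto simp: z_def)
    have "cmod (G (z + 1) - G z) \<le> e * cmod ((z + 1) - z)"
    proof (rule field_differentiable_bound[where f' = f and S = "closed_segment z (z + 1)"])
      fix w assume "w \<in> closed_segment z (z + 1)"
      then have w: "Im w = Im z"
        by (rule Im_closed_segment_eq) simp_all
      show "(G has_field_derivative f w) (at w within closed_segment z (z + 1))"
        using w z by (intro has_field_derivative_at_within[OF G]) simp
      show "cmod (f w) \<le> e"
        using Y[of w] w z by simp
    qed auto
    then show ?thesis
      using const[OF z(1)] by simp
  qed
  then have "cmod (G (\<i> + 1) - G \<i>) \<le> 0"
    using field_le_epsilon[of "cmod (G (\<i> + 1) - G \<i>)" 0] by simp
  then have periodic: "G (z + 1) = G z" if "Im z > 0" for z
    using const[OF that] by simp
  show ?thesis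
    by (rule periodic_primitive_convergent[OF G periodic hol cusp_form_tendsto_0[OF fuchsian f] that])
qed

lemma contour_integral_linepath_primitive:
  assumes G: "\<And>z. Im z > 0 \<Longrightarrow> (G has_field_derivative f z) (at z)"
    and "Im a > 0" "Im b > 0"
  shows "contour_integral (linepath a b) f = G b - G a"
proof -
  have "closed_segment a b \<subseteq> upper_half_plane"
    using assms convex_upper_half_plane by (intro closed_segment_subset) auto
  then have "(f has_contour_integral (G (pathfinish (linepath a b)) - G (pathstart (linepath a b))))
      (linepath a b)"
    by (intro contour_integral_primitive[of upper_half_plane])
       (auto intro: has_field_derivative_at_within[OF G])
  then show ?thesis
    by (simp add: contour_integral_unique)
qed

text \<open>On the half-plane the cusp primitive equals 2 pi \<open>\<i>\<close> times
  \<open>G - l\<close> with the same \<open>l\<close> everywhere, so \<open>l\<close> drops out of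
  the difference, and by \<open>inv\<close> the increment of \<open>G\<close> from \<open>z\<close>
  to \<open>mobius g z\<close> is the one from the base point \<open>\<i>\<close>.\<close>

lemma cusp_primitive_mobius:
  assumes fuchsian: "normalized_fuchsian_first_kind \<Gamma>" and f: "f \<in> cusp_forms_weight2 \<Gamma>"
    and g: "g \<in> \<Gamma>" and z: "Im z > 0"
  shows "cusp_primitive f (mobius g z) = cusp_primitive f z + modular_symbol f g"
proof -
  obtain G where G: "\<And>z. Im z > 0 \<Longrightarrow> (G has_field_derivative f z) (at z)"
    and inv: "\<And>g z. g \<in> \<Gamma> \<Longrightarrow> Im z > 0 \<Longrightarrow> G (mobius g z) - G z = G (mobius g \<i>) - G \<i>"
    using cusp_form_primitive[OF fuchsian f] by blast
  obtain l where l: "\<And>z. ((\<lambda>T. G (z + \<i> * of_real T)) \<longlongrightarrow> l) at_top"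
    using cusp_form_primitive_convergent[OF fuchsian f G inv] by blast
  have primitive: "cusp_primitive f w = 2 * of_real pi * \<i> * (G w - l)" if w: "Im w > 0" for w
    unfolding cusp_primitive_def
  proof (rule tendsto_Lim)
    show "((\<lambda>T. 2 * of_real pi * \<i> * contour_integral (linepath (w + \<i> * of_real T) w) f)
            \<longlongrightarrow> 2 * of_real pi * \<i> * (G w - l)) at_top"
    proof (rule Lim_transform_eventually)
      show "((\<lambda>T. 2 * of_real pi * \<i> * (G w - G (w + \<i> * of_real T)))
              \<longlongrightarrow> 2 * of_real pi * \<i> * (G w - l)) at_top"
        by (intro tendsto_intros l)
      show "eventually (\<lambda>T. 2 * of_real pi * \<i> * (G w - G (w + \<i> * of_real T)) =
              2 * of_real pi * \<i> * contour_integral (linepath (w + \<i> * of_real T) w) f) at_top"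
        using eventually_ge_at_top[of 0]
        by eventually_elim (use w in \<open>simp add: contour_integral_linepath_primitive[OF G]\<close>)
    qed
  qed simp
  have det: "det g = 1"
    using det_normalized_fuchsian[OF fuchsian g] .
  have "modular_symbol f g = 2 * of_real pi * \<i> * (G (mobius g z) - G z)"
    using inv[OF g z] Im_mobius_pos[OF det, of \<i>]
    by (simp add: modular_symbol_def contour_integral_linepath_primitive[OF G])
  then show ?thesis
    using z Im_mobius_pos[OF det z] by (simp add: primitive algebra_simps)
qed

text \<open>Both sides are the increment of the cusp primitive from \<open>\<i>\<close> to its image
  under \<open>g ** h\<close>, taken at once or through \<open>mobius h \<i>\<close>.\<close>

lemma modular_symbol_mult:
  assumes fuchsian: "normalized_fuchsian_first_kind \<Gamma>" and f: "f \<in> cusp_forms_weight2 \<Gamma>"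
    and g: "g \<in> \<Gamma>" and h: "h \<in> \<Gamma>"
  shows "modular_symbol f (g ** h) = modular_symbol f g + modular_symbol f h"
proof -
  have det: "det h = 1"
    using det_normalized_fuchsian[OF fuchsian h] .
  have "cusp_primitive f (mobius (g ** h) \<i>) =
          cusp_primitive f \<i> + modular_symbol f h + modular_symbol f g"
    using cusp_primitive_mobius[OF fuchsian f g Im_mobius_pos[OF det, of \<i>]]
      cusp_primitive_mobius[OF fuchsian f h, of \<i>]
    by (simp add: mobius_mult[OF det])
  then show ?thesis
    using cusp_primitive_mobius[OF fuchsian f mult_normalized_fuchsian[OF fuchsian g h], of \<i>]
    by simp
qed

section \<open>The cocycle relation for \<open>\<theta>\<close>\<close>

lemma dedekind_symbol_difference_mult:
  assumes fuchsian: "normalized_fuchsian_first_kind \<Gamma>"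
    and symbol: "modular_dedekind_symbol \<Gamma> S"
    and \<gamma>: "\<gamma> \<in> \<Gamma>" and \<tau>: "\<tau> \<in> \<Gamma>"
    and f: "f \<in> cusp_forms_weight2 \<Gamma>"
    and higher: "higher_dedekind_symbol \<Gamma> f m S'"
  shows "S' (\<gamma> ** \<tau>) - S (\<gamma> ** \<tau>) = (S' \<gamma> - S \<gamma>) + (S' \<tau> - S \<tau>)
           + V_form \<Gamma> f / (2 * pi) * Im (modular_symbol f \<gamma> * cnj (modular_symbol f \<tau>))"
proof -
  obtain L where L: "\<And>g z. g \<in> \<Gamma> \<Longrightarrow> Im z > 0 \<Longrightarrow>
      L (mobius g z) = L z + 1/2 * Ln (autj g z) + of_real pi * \<i> * of_real (S g)"
    using symbol
    unfolding modular_dedekind_symbol_def Ball_def upper_half_plane_iff by blast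
  obtain L' where L': "\<And>g z. g \<in> \<Gamma> \<Longrightarrow> Im z > 0 \<Longrightarrow>
      L' (mobius g z) = L' z + 1/2 * Ln (autj g z) + of_real pi * \<i> * of_real (S' g)
        - of_real (V_form \<Gamma> f / 4) * (2 * cnj (modular_symbol f g) * cusp_primitive f z
            + of_real ((cmod (modular_symbol f g))\<^sup>2))"
    using higher
    unfolding higher_dedekind_symbol_def Ball_def upper_half_plane_iff by blast
  define V where "V = complex_of_real (V_form \<Gamma> f / 4)"
  define D where "D z = L' z - L z" for z
  \<comment> \<open>The logarithms of \<open>autj\<close> are the same in both laws and cancel in
    \<open>D\<close>, so no branch question arises. The squared modulus is written with the
    conjugate to make the later comparison polynomial.\<close>
  have D: "D (mobius g z) = D z + of_real pi * \<i> * of_real (S' g - S g)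
        - V * (2 * cnj (modular_symbol f g) * cusp_primitive f z
               + modular_symbol f g * cnj (modular_symbol f g))" if "g \<in> \<Gamma>" "Im z > 0" for g z
    using L[OF that] L'[OF that, unfolded complex_norm_square]
    by (simp add: D_def V_def algebra_simps)
  define x where "x = modular_symbol f \<gamma>"
  define y where "y = modular_symbol f \<tau>"
  have det: "det \<tau> = 1"
    using det_normalized_fuchsian[OF fuchsian \<tau>] .
  define w where "w = mobius \<tau> \<i>"
  have w: "Im w > 0"
    by (simp add: w_def Im_mobius_pos[OF det])
  define F where "F = cusp_primitive f \<i>"
  define p where "p = of_real pi * \<i>"
  have "D w = D \<i> + p * of_real (S' \<tau> - S \<tau>) - V * (2 * cnj y * F + y * cnj y)"
    using D[OF \<tau>, of \<i>] by (simp add: w_def y_def F_def p_def)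
  moreover have "D (mobius \<gamma> w) =
      D w + p * of_real (S' \<gamma> - S \<gamma>) - V * (2 * cnj x * (F + y) + x * cnj x)"
    using D[OF \<gamma> w] cusp_primitive_mobius[OF fuchsian f \<tau>, of \<i>]
    by (simp add: w_def x_def y_def F_def p_def)
  moreover have "D (mobius \<gamma> w) = D \<i> + p * of_real (S' (\<gamma> ** \<tau>) - S (\<gamma> ** \<tau>))
      - V * (2 * (cnj x + cnj y) * F + (x + y) * (cnj x + cnj y))"
    using D[OF mult_normalized_fuchsian[OF fuchsian \<gamma> \<tau>], of \<i>]
    by (simp add: modular_symbol_mult[OF fuchsian f \<gamma> \<tau>] mobius_mult[OF det]
        w_def x_def y_def F_def p_def)
  \<comment> \<open>All terms in \<open>F\<close> and the squares of |x| and |y| cancel. The mixed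
    terms \<open>x * cnj y + cnj x * y\<close> of |x + y|^2, less the \<open>2 * cnj x * y\<close>
    caused by the shift from \<open>F\<close> to \<open>F + y\<close>, leave an antisymmetric
    expression.\<close>
  ultimately have "p * (of_real (S' (\<gamma> ** \<tau>) - S (\<gamma> ** \<tau>)) - of_real (S' \<gamma> - S \<gamma>)
      - of_real (S' \<tau> - S \<tau>)) = V * (x * cnj y - cnj x * y)"
    by algebra
  then have "of_real pi * \<i> *
      of_real ((S' (\<gamma> ** \<tau>) - S (\<gamma> ** \<tau>)) - (S' \<gamma> - S \<gamma>) - (S' \<tau> - S \<tau>))
      = V * (x * cnj y - cnj (x * cnj y))"
    by (simp add: p_def)
  also have "x * cnj y - cnj (x * cnj y) = of_real (2 * Im (x * cnj y)) * \<i>"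
    by (rule complex_diff_cnj)
  also have "V * \<dots> = of_real (V_form \<Gamma> f / 2 * Im (x * cnj y)) * \<i>"
    by (simp add: V_def)
  finally have "pi * ((S' (\<gamma> ** \<tau>) - S (\<gamma> ** \<tau>)) - (S' \<gamma> - S \<gamma>) - (S' \<tau> - S \<tau>)) =
      V_form \<Gamma> f / 2 * Im (x * cnj y)"
    by (simp only: complex_eq_iff) simp
  then show ?thesis
    by (simp add: x_def y_def field_simps)
qed

section \<open>The trace terms and assembly of both identities\<close>

text \<open>The first columns of \<open>\<gamma>\<close> and \<open>\<gamma> ** \<tau>\<close> are
  the images under \<open>\<gamma>\<close> of the first unit vector and of the first column of
  \<open>\<tau>\<close>; their determinant is therefore
  \<open>det \<gamma> * entry_c \<tau>\<close>.\<close>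

lemma trace_over_c_diff:
  assumes "det \<gamma> = 1" "entry_c \<gamma> \<noteq> 0" "entry_c (\<gamma> ** \<tau>) \<noteq> 0"
  shows "(entry_a \<gamma> + entry_d \<gamma>) / entry_c \<gamma>
           - (entry_a (\<gamma> ** \<tau>) + entry_d (\<gamma> ** \<tau>)) / entry_c (\<gamma> ** \<tau>) =
         entry_d \<gamma> / entry_c \<gamma> - entry_d (\<gamma> ** \<tau>) / entry_c (\<gamma> ** \<tau>)
           + entry_c \<tau> / (entry_c \<gamma> * entry_c (\<gamma> ** \<tau>))"
proof -
  have "entry_a \<gamma> * entry_c (\<gamma> ** \<tau>) - entry_a (\<gamma> ** \<tau>) * entry_c \<gamma> = det \<gamma> * entry_c \<tau>"
    by (simp add: entries_matrix_mult det_2 algebra_simps)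
  then have "entry_a \<gamma> / entry_c \<gamma> - entry_a (\<gamma> ** \<tau>) / entry_c (\<gamma> ** \<tau>) =
      entry_c \<tau> / (entry_c \<gamma> * entry_c (\<gamma> ** \<tau>))"
    using assms by (simp add: diff_frac_eq mult.commute)
  then show ?thesis
    by (simp add: add_divide_distrib)
qed

theorem theorem1p6:
  fixes \<Gamma> :: "(real^2^2) set" and S :: "real^2^2 \<Rightarrow> real" and \<gamma> \<tau> :: "real^2^2"
  assumes "normalized_fuchsian_first_kind \<Gamma>"
    and "modular_dedekind_symbol \<Gamma> S"
    and "\<gamma> \<in> \<Gamma>" and "\<tau> \<in> \<Gamma>"
    and "entry_c \<gamma> * entry_c \<tau> * entry_c (\<gamma> ** \<tau>) \<noteq> 0"
  shows "H_symbol \<Gamma> S \<gamma> - H_symbol \<Gamma> S (\<gamma> ** \<tau>) =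
           A_const \<Gamma> * (entry_d \<gamma> / entry_c \<gamma> - entry_d (\<gamma> ** \<tau>) / entry_c (\<gamma> ** \<tau>)
                          + entry_c \<tau> / (entry_c \<gamma> * entry_c (\<gamma> ** \<tau>)))
           + S \<tau>
           + 1/4 * (sgn (entry_c \<tau>) - sgn (entry_c \<gamma> * entry_c \<tau> * entry_c (\<gamma> ** \<tau>)))
         \<and> (\<forall>f m S_star \<theta>.
              f \<in> cusp_forms_weight2 \<Gamma> \<longrightarrow> (\<exists>z\<in>upper_half_plane. f z \<noteq> 0) \<longrightarrow>
              m \<ge> 1 \<longrightarrow> higher_dedekind_symbol \<Gamma> f m S_star \<longrightarrow>
              \<theta> = (\<lambda>g. S_star g - S g) \<longrightarrow>
              H_star \<Gamma> \<theta> \<gamma> - H_star \<Gamma> \<theta> (\<gamma> ** \<tau>) =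
                A_const \<Gamma> * (entry_d \<gamma> / entry_c \<gamma> - entry_d (\<gamma> ** \<tau>) / entry_c (\<gamma> ** \<tau>)
                               + entry_c \<tau> / (entry_c \<gamma> * entry_c (\<gamma> ** \<tau>)))
                - \<theta> \<tau>
                - V_form \<Gamma> f / (2 * pi) * Im (modular_symbol f \<gamma> * cnj (modular_symbol f \<tau>)))"
proof -
  note fuchsian = assms(1) and symbol = assms(2) and \<gamma> = assms(3) and \<tau> = assms(4) and c = assms(5)
  have nz: "entry_c \<gamma> \<noteq> 0" "entry_c (\<gamma> ** \<tau>) \<noteq> 0"
    using c by auto
  note trace = trace_over_c_diff[OF det_normalized_fuchsian[OF fuchsian \<gamma>] nz, symmetric]
  show ?thesis
  proof (intro conjI allI impI)
    show "H_symbol \<Gamma> S \<gamma> - H_symbol \<Gamma> S (\<gamma> ** \<tau>) =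
           A_const \<Gamma> * (entry_d \<gamma> / entry_c \<gamma> - entry_d (\<gamma> ** \<tau>) / entry_c (\<gamma> ** \<tau>)
                          + entry_c \<tau> / (entry_c \<gamma> * entry_c (\<gamma> ** \<tau>)))
           + S \<tau>
           + 1/4 * (sgn (entry_c \<tau>) - sgn (entry_c \<gamma> * entry_c \<tau> * entry_c (\<gamma> ** \<tau>)))"
      \<comment> \<open>The sign corrections in \<open>H_symbol\<close> cancel the signs of
        \<open>entry_c \<gamma>\<close> and \<open>entry_c (\<gamma> ** \<tau>)\<close> in the
        defect of \<open>S\<close>; those of \<open>entry_c \<tau>\<close> and of the triple product
        survive.\<close>
      unfolding H_symbol_def trace
      using nz modular_dedekind_symbol_mult[OF fuchsian symbol \<gamma> \<tau> c]
      by (simp add: right_diff_distrib add_divide_distrib diff_divide_distrib)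
  next
    fix f m S_star \<theta>
    assume f: "f \<in> cusp_forms_weight2 \<Gamma>" and higher: "higher_dedekind_symbol \<Gamma> f m S_star"
      and \<theta>: "\<theta> = (\<lambda>g. S_star g - S g)"
    show "H_star \<Gamma> \<theta> \<gamma> - H_star \<Gamma> \<theta> (\<gamma> ** \<tau>) =
                A_const \<Gamma> * (entry_d \<gamma> / entry_c \<gamma> - entry_d (\<gamma> ** \<tau>) / entry_c (\<gamma> ** \<tau>)
                               + entry_c \<tau> / (entry_c \<gamma> * entry_c (\<gamma> ** \<tau>)))
                - \<theta> \<tau>
                - V_form \<Gamma> f / (2 * pi) * Im (modular_symbol f \<gamma> * cnj (modular_symbol f \<tau>))"
      unfolding H_star_def trace
      using nz dedekind_symbol_difference_mult[OF fuchsian symbol \<gamma> \<tau> f higher]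
      by (simp add: right_diff_distrib \<theta>)
  qed
qed

end
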